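(* Let $m\in\mathbb{N}=\{1,2,3,\dots\}$, $h\in\mathbb{Z}$ and $x\in\mathbb{Z}_p$. Then $$E_{m,q^{-1}}^{(h,1)}(1-x)=(-1)^mq^{m+h-1}E_{m,q}^{(h,1)}(x).$$ In particular, $$E_{m,q^{-1}}^{(h,1)}(0)=(-1)^mq^{m+h-1}E_{m,q}^{(h,1)}(1)=(-1)^{m-1}q^{m-1}E_{m,q}^{(h,1)},$$ where $E_{m,q}^{(h,1)}=E_{m,q}^{(h,1)}(0)$.
   Context: Let $p$ be an odd prime, $\mathbb{C}_p$ the completion of the algebraic closure of $\mathbb{Q}_p$, with $|p|_p=p^{-1}$. Let $q\in\mathbb{C}_p$ with $|1-q|_p<p^{-1/(p-1)}$ (then $q^{-1}$ satisfies the same condition). For $Q\in\{q,q^{-1}\}$ and $x\in\mathbb{Z}_p$ put $Q^x=\exp(x\log Q)$, $[x]_Q=\frac{1-Q^x}{1-Q}$, $[2]_Q=1+Q$. For $f:\mathbb{Z}_p\to\mathbb{C}_p$ (uniformly differentiable) define $$\int_{\mathbb{Z}_p}f(x)\,d\mu_{-Q}(x)=\lim_{N\to\infty}\frac{[2]_Q}{1+Q^{p^N}}\sum_{x=0}^{p^N-1}f(x)(-1)^xQ^x.$$ For $h\in\mathbb{Z}$, integers $m\ge0$ and $x\in\mathbb{Z}_p$ define $$E_{m,Q}^{(h,1)}(x)=\int_{\mathbb{Z}_p}[x+x_1]_Q^m\,Q^{(h-1)x_1}\,d\mu_{-Q}(x_1).$$ *)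

theory Defs
  imports "HOL-Analysis.Analysis" "HOL-Computational_Algebra.Polynomial"
begin

text \<open>
  Fields with a non-archimedean absolute value, as metric spaces. The library's \<open>norm\<close> is tied
  to real vector spaces, hence the separate name \<open>vabs\<close>. Definiteness and symmetry of \<open>vabs\<close> come
  from the metric.
\<close>

class ultrametric_field = field_char_0 + metric_space +
  fixes vabs :: "'a \<Rightarrow> real"
  assumes dist_vabs: "dist x y = vabs (x - y)"
    and vabs_mult: "vabs (x * y) = vabs x * vabs y"
    and vabs_add_le_max: "vabs (x + y) \<le> max (vabs x) (vabs y)"

text \<open>
  The type \<open>'a\<close> is \<open>\<complex>\<^sub>p\<close> if it is a completion of an algebraic closure of a completion of the
  rationals with respect to the absolute value normalised by \<open>|p| = 1/p\<close>. In a complete field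
  the closure of the rationals is their completion \<open>\<rat>\<^sub>p\<close>; the elements algebraic over it have to
  form an algebraically closed field which is dense. These conditions determine \<open>'a\<close> up to
  isometric isomorphism.
\<close>

definition padic_rationals :: "'a::ultrametric_field set" where
  "padic_rationals = closure \<rat>"

definition padic_integers :: "'a::ultrametric_field set" where
  "padic_integers = {x \<in> padic_rationals. vabs x \<le> 1}"

definition padic_algebraic :: "'a::ultrametric_field set" where
  "padic_algebraic =
    {z. \<exists>P. P \<noteq> 0 \<and> (\<forall>i. coeff P i \<in> padic_rationals) \<and> poly P z = 0}"

definition is_padic_complex_field :: "nat \<Rightarrow> 'a::ultrametric_field itself \<Rightarrow> bool" where
  "is_padic_complex_field p T \<longleftrightarrow>
     vabs (of_nat p :: 'a) = 1 / real p \<and>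
     complete (UNIV :: 'a set) \<and>
     (\<forall>P :: 'a poly. degree P > 0 \<and> (\<forall>i. coeff P i \<in> padic_algebraic) \<longrightarrow>
        (\<exists>z \<in> padic_algebraic. poly P z = 0)) \<and>
     closure (padic_algebraic :: 'a set) = UNIV"

definition padic_exp :: "'a::ultrametric_field \<Rightarrow> 'a" where
  "padic_exp z = (\<Sum>n. z ^ n / fact n)"

definition padic_log :: "'a::ultrametric_field \<Rightarrow> 'a" where
  "padic_log z = (\<Sum>n. (-1) ^ n * (z - 1) ^ Suc n / of_nat (Suc n))"

definition padic_pow :: "'a::ultrametric_field \<Rightarrow> 'a \<Rightarrow> 'a" where
  "padic_pow Q x = padic_exp (x * padic_log Q)"

text \<open>For \<open>Q = 1\<close> the quotient is read as its limit \<open>x\<close>.\<close>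

definition qnumber :: "'a::ultrametric_field \<Rightarrow> 'a \<Rightarrow> 'a" where
  "qnumber Q x = (if Q = 1 then x else (1 - padic_pow Q x) / (1 - Q))"

text \<open>
  The integral of \<open>f\<close> over \<open>\<int>\<^sub>p\<close> against \<open>\<mu>\<^bsub>-Q\<^esub>\<close>; the prefactor \<open>1 + Q\<close> is \<open>[2]\<^sub>Q\<close>.
\<close>

definition fermionic_integral ::
    "nat \<Rightarrow> 'a::ultrametric_field \<Rightarrow> ('a \<Rightarrow> 'a) \<Rightarrow> 'a" where
  "fermionic_integral p Q f =
     lim (\<lambda>N. (1 + Q) / (1 + Q ^ (p ^ N)) * (\<Sum>x<p ^ N. f (of_nat x) * (-1) ^ x * Q ^ x))"

text \<open>\<open>qeuler p h m Q x\<close> is \<open>E\<^bsub>m,Q\<^esub>\<^bsup>(h,1)\<^esup>(x)\<close>.\<close>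

definition qeuler :: "nat \<Rightarrow> int \<Rightarrow> nat \<Rightarrow> 'a::ultrametric_field \<Rightarrow> 'a \<Rightarrow> 'a" where
  "qeuler p h m Q x =
     fermionic_integral p Q (\<lambda>y. qnumber Q (x + y) ^ m * padic_pow Q (of_int (h - 1) * y))"

end

theory Submission
  imports Defs "HOL-Computational_Algebra.Primes"
begin

text \<open>
  Write \<open>P = p ^ N\<close>. The weighted integrand \<open>w(y) = [x + y]\<^sub>q ^ m q ^ (h y)\<close> extends to all integers
  and satisfies \<open>|w(k + n) - w(k)| \<le> |n|\<close>, so its alternating sums over \<open>y < P\<close> converge.
  Substituting \<open>y \<mapsto> P - 1 - y\<close> in the sum for \<open>(q\<inverse>, 1 - x)\<close> turns it, because the \<open>q\<inverse>\<close>-number of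
  \<open>-t\<close> is \<open>-q [t]\<^sub>q\<close>, into a constant times the sum of \<open>w(y - P)\<close>, which differs from the
  sum of \<open>w(y)\<close> by at most \<open>|P|\<close>. The second identity is a telescoping of alternating sums.
  No division by \<open>1 - q\<close> is needed, so \<open>q = 1\<close> is not special.

  The argument uses \<open>exp (log q) = q\<close>. This follows from
  \<open>log u = lim (u ^ P - 1) / P\<close> and \<open>|u ^ P - 1| = |P| |u - 1|\<close>.
\<close>

section \<open>Fields with an ultrametric absolute value\<close>

lemma vabs_zero [simp]: "vabs (0::'a::ultrametric_field) = 0"
  by (metis diff_self dist_self dist_vabs)

lemma vabs_nonneg [simp]: "0 \<le> vabs (x::'a::ultrametric_field)"
  by (metis diff_zero dist_vabs zero_le_dist)

lemma vabs_eq_0_iff [simp]: "vabs (x::'a::ultrametric_field) = 0 \<longleftrightarrow> x = 0"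
  by (metis diff_zero dist_eq_0_iff dist_vabs)

lemma vabs_pos_iff [simp]: "0 < vabs (x::'a::ultrametric_field) \<longleftrightarrow> x \<noteq> 0"
  by (simp add: less_le)

lemma vabs_le_0_iff [simp]: "vabs (x::'a::ultrametric_field) \<le> 0 \<longleftrightarrow> x = 0"
  by (simp flip: vabs_eq_0_iff add: order_antisym_conv del: vabs_eq_0_iff)

lemma vabs_one [simp]: "vabs (1::'a::ultrametric_field) = 1"
  using vabs_mult[of "1::'a" 1] by simp

lemma vabs_minus [simp]: "vabs (- x::'a::ultrametric_field) = vabs x"
  by (metis diff_0 diff_zero dist_commute dist_vabs)

lemma vabs_minus_commute: "vabs (x - y::'a::ultrametric_field) = vabs (y - x)"
  by (metis dist_commute dist_vabs)

lemma vabs_diff_le_max: "vabs (x - y::'a::ultrametric_field) \<le> max (vabs x) (vabs y)"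
  using vabs_add_le_max[of x "- y"] by simp

lemma vabs_power: "vabs (x ^ n::'a::ultrametric_field) = vabs x ^ n"
  by (induction n) (simp_all add: vabs_mult)

lemma vabs_inverse: "vabs (inverse x::'a::ultrametric_field) = inverse (vabs x)"
proof (cases "x = 0")
  case False
  then have "vabs x * vabs (inverse x) = 1"
    by (simp flip: vabs_mult)
  then show ?thesis
    by (simp add: inverse_unique)
qed simp

lemma vabs_divide: "vabs (x / y::'a::ultrametric_field) = vabs x / vabs y"
  by (simp add: divide_inverse vabs_mult vabs_inverse)

lemma vabs_powi: "vabs (x powi k::'a::ultrametric_field) = vabs x powi k"
  by (simp add: power_int_def vabs_power vabs_inverse)

lemma vabs_sum_le:
  fixes f :: "'b \<Rightarrow> 'a::ultrametric_field"
  assumes "\<And>i. i \<in> A \<Longrightarrow> vabs (f i) \<le> B" and "0 \<le> B"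
  shows "vabs (sum f A) \<le> B"
  using assms(1)
proof (induction A rule: infinite_finite_induct)
  case (insert a A)
  then have "max (vabs (f a)) (vabs (sum f A)) \<le> B"
    by simp
  then show ?case
    using insert.hyps vabs_add_le_max[of "f a" "sum f A"] by simp linarith
qed (use assms(2) in auto)

text \<open>As \<open>x = (x - y) + y\<close> and \<open>y = x - (x - y)\<close>, the ultrametric
  inequality bounds each value by the other once the difference is strictly smaller than
  \<open>y\<close>.\<close>

lemma vabs_eq_of_diff_less:
  fixes x y :: "'a::ultrametric_field"
  assumes "vabs (x - y) < vabs y"
  shows "vabs x = vabs y"
  using vabs_add_le_max[of "x - y" y] vabs_diff_le_max[of x "x - y"] assms by simp

lemma vabs_of_nat_le_1: "vabs (of_nat n::'a::ultrametric_field) \<le> 1"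
proof (induction n)
  case (Suc n)
  then show ?case
    using vabs_add_le_max[of 1 "of_nat n::'a"] by simp
qed simp

lemma vabs_of_int_le_1: "vabs (of_int k::'a::ultrametric_field) \<le> 1"
  by (cases k rule: int_cases2) (simp_all add: vabs_of_nat_le_1)

lemma tendsto_iff_vabs:
  "(f \<longlongrightarrow> (l::'a::ultrametric_field)) F \<longleftrightarrow> ((\<lambda>x. vabs (f x - l)) \<longlongrightarrow> 0) F"
  by (subst tendsto_dist_iff) (simp only: dist_vabs)

lemma tendsto_vabs_bound:
  fixes l :: "'a::ultrametric_field"
  assumes "\<And>x. vabs (f x - l) \<le> g x" and "(g \<longlongrightarrow> 0) F"
  shows "(f \<longlongrightarrow> l) F"
  unfolding tendsto_iff_vabs
  by (rule tendsto_sandwich[OF _ _ tendsto_const assms(2)]) (use assms(1) in auto)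

lemma LIMSEQ_vabs_bound:
  fixes X :: "nat \<Rightarrow> 'a::ultrametric_field"
  assumes "X \<longlonglongrightarrow> l" and "\<And>n. vabs (X n - a) \<le> B"
  shows "vabs (l - a) \<le> B"
proof -
  have "(\<lambda>n. dist (X n) a) \<longlonglongrightarrow> dist l a"
    by (intro tendsto_dist assms tendsto_const)
  then show ?thesis
    using assms(2) by (intro LIMSEQ_le_const2[where X="\<lambda>n. vabs (X n - a)"]) (auto simp: dist_vabs)
qed

lemma sums_vabs_bound:
  fixes f :: "nat \<Rightarrow> 'a::ultrametric_field"
  assumes "f sums s" and "\<And>n. vabs (f n) \<le> B"
  shows "vabs s \<le> B"
proof -
  have "0 \<le> B"
    using assms(2)[of 0] vabs_nonneg order_trans by blast
  then have "vabs (sum f {..<n} - 0) \<le> B" for n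
    using vabs_sum_le[of "{..<n}" f B] assms(2) by simp
  then have "vabs (s - 0) \<le> B"
    using assms(1) LIMSEQ_vabs_bound unfolding sums_def by blast
  then show ?thesis by simp
qed

section \<open>Continuity of addition and multiplication\<close>

instance ultrametric_field \<subseteq> topological_group_add
proof
  fix a b :: 'a
  let ?F = "nhds a \<times>\<^sub>F nhds b"
  have fst: "((\<lambda>x. vabs (fst x - a)) \<longlongrightarrow> 0) ?F"
    using filterlim_fst[of "nhds a" "nhds b"] by (simp add: tendsto_iff_vabs)
  have snd: "((\<lambda>x. vabs (snd x - b)) \<longlongrightarrow> 0) ?F"
    using filterlim_snd[of "nhds b" "nhds a"] by (simp add: tendsto_iff_vabs)
  show "((\<lambda>x. fst x + snd x) \<longlongrightarrow> a + b) ?F"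
  proof (rule tendsto_vabs_bound[where g = "\<lambda>x. vabs (fst x - a) + vabs (snd x - b)"])
    show "((\<lambda>x. vabs (fst x - a) + vabs (snd x - b)) \<longlongrightarrow> 0) ?F"
      using tendsto_add[OF fst snd] by simp
    fix x :: "'a \<times> 'a"
    have "vabs (fst x + snd x - (a + b)) \<le> max (vabs (fst x - a)) (vabs (snd x - b))"
      using vabs_add_le_max[of "fst x - a" "snd x - b"] by (simp add: algebra_simps)
    also have "\<dots> \<le> vabs (fst x - a) + vabs (snd x - b)"
      by simp
    finally show "vabs (fst x + snd x - (a + b)) \<le> vabs (fst x - a) + vabs (snd x - b)" .
  qed
next
  fix a :: 'a
  have "((\<lambda>x. vabs (x - a)) \<longlongrightarrow> 0) (nhds a)"
    using filterlim_ident[of "nhds a"] by (simp only: tendsto_iff_vabs)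
  moreover have "vabs (- x - - a) = vabs (x - a)" for x
    by (metis minus_diff_minus vabs_minus)
  ultimately show "(uminus \<longlongrightarrow> - a) (nhds a)"
    by (simp only: tendsto_iff_vabs)
qed

instance ultrametric_field \<subseteq> topological_semigroup_mult
proof
  fix a b :: 'a
  let ?F = "nhds a \<times>\<^sub>F nhds b"
  have fst: "((\<lambda>x. vabs (fst x - a)) \<longlongrightarrow> 0) ?F"
    using filterlim_fst[of "nhds a" "nhds b"] by (simp add: tendsto_iff_vabs)
  have snd: "((\<lambda>x. vabs (snd x - b)) \<longlongrightarrow> 0) ?F"
    using filterlim_snd[of "nhds b" "nhds a"] by (simp add: tendsto_iff_vabs)
  let ?g = "\<lambda>x. vabs (fst x - a) * vabs (snd x - b) + vabs a * vabs (snd x - b)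
                  + vabs b * vabs (fst x - a)"
  show "((\<lambda>x. fst x * snd x) \<longlongrightarrow> a * b) ?F"
  proof (rule tendsto_vabs_bound[where g = ?g])
    have "(?g \<longlongrightarrow> 0 * 0 + vabs a * 0 + vabs b * 0) ?F"
      by (intro tendsto_intros fst snd)
    then show "(?g \<longlongrightarrow> 0) ?F" by simp
    fix x :: "'a \<times> 'a"
    \<comment> \<open>Expanded around \<open>(a, b)\<close>, every summand has a factor that tends
      to \<open>0\<close>.\<close>
    have "fst x * snd x - a * b = (fst x - a) * (snd x - b) + a * (snd x - b) + b * (fst x - a)"
      by (simp add: algebra_simps)
    then have "vabs (fst x * snd x - a * b)
        \<le> max (max (vabs ((fst x - a) * (snd x - b))) (vabs (a * (snd x - b)))) (vabs (b * (fst x - a)))"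
      by (smt (verit) vabs_add_le_max)
    also have "\<dots> \<le> ?g x"
      by (simp add: vabs_mult)
    finally show "vabs (fst x * snd x - a * b) \<le> ?g x" .
  qed
qed

section \<open>Convergence criteria and auxiliary sums\<close>

text \<open>The distance from \<open>X N\<close> to \<open>X (N + k)\<close> is at most the largest
  increment in between, so increments tending to \<open>0\<close> already make \<open>X\<close> a
  Cauchy sequence.\<close>

lemma convergent_of_vabs_increments:
  fixes X :: "nat \<Rightarrow> 'a::ultrametric_field"
  assumes "complete (UNIV :: 'a set)" and "\<And>n. vabs (X (Suc n) - X n) \<le> g n" and "g \<longlonglongrightarrow> 0"
  shows "convergent X"
proof -
  have "Cauchy X"
  proof (rule metric_CauchyI)
    fix e :: real
    assume "0 < e"
    then have "\<forall>\<^sub>F n in sequentially. g n < e"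
      using order_tendstoD(2)[OF assms(3)] by blast
    then obtain N where N: "\<And>n. n \<ge> N \<Longrightarrow> g n < e"
      by (auto simp: eventually_sequentially)
    have near: "vabs (X (N + k) - X N) < e" for k
    proof (induction k)
      case (Suc k)
      have "vabs (X (Suc (N + k)) - X (N + k)) < e"
        using assms(2) N le_add1 order_le_less_trans by blast
      then show ?case
        using Suc vabs_add_le_max[of "X (Suc (N + k)) - X (N + k)" "X (N + k) - X N"] by simp
    qed (use \<open>0 < e\<close> in simp)
    have "dist (X m) (X n) < e" if "m \<ge> N" "n \<ge> N" for m n
      using near[of "m - N"] near[of "n - N"] that
        vabs_diff_le_max[of "X m - X N" "X n - X N"] by (simp add: dist_vabs)
    then show "\<exists>M. \<forall>m\<ge>M. \<forall>n\<ge>M. dist (X m) (X n) < e" by blast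
  qed
  then show ?thesis
    using assms(1) by (auto simp: complete_def convergent_def)
qed

lemma summable_of_vabs_bound:
  fixes f :: "nat \<Rightarrow> 'a::ultrametric_field"
  assumes "complete (UNIV :: 'a set)" and "\<And>n. vabs (f n) \<le> g n" and "g \<longlonglongrightarrow> 0"
  shows "summable f"
  unfolding summable_iff_convergent
  by (rule convergent_of_vabs_increments[OF assms(1) _ assms(3)]) (use assms(2) in simp)

lemma vabs_power_diff_le:
  fixes a b :: "'a::ultrametric_field"
  assumes "vabs a \<le> 1" and "vabs b \<le> 1"
  shows "vabs (a ^ m - b ^ m) \<le> vabs (a - b)"
proof (induction m)
  case (Suc m)
  have "a ^ Suc m - b ^ Suc m = a * (a ^ m - b ^ m) + (a - b) * b ^ m"
    by (simp add: algebra_simps)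
  then have "vabs (a ^ Suc m - b ^ Suc m)
      \<le> max (vabs a * vabs (a ^ m - b ^ m)) (vabs (a - b) * vabs b ^ m)"
    using vabs_add_le_max by (metis vabs_mult vabs_power)
  moreover have "vabs a * vabs (a ^ m - b ^ m) \<le> 1 * vabs (a - b)"
    using Suc assms by (intro mult_mono) auto
  moreover have "vabs (a - b) * vabs b ^ m \<le> vabs (a - b) * 1"
    using assms by (intro mult_left_mono power_le_one) auto
  ultimately show ?case by simp
qed simp

lemma sum_lessThan_add:
  fixes f :: "nat \<Rightarrow> 'b::comm_monoid_add"
  shows "(\<Sum>y<a + b. f y) = (\<Sum>y<a. f y) + (\<Sum>y<b. f (a + y))"
  by (induction b) (simp_all add: add.assoc)

lemma alternating_telescope:
  fixes g :: "nat \<Rightarrow> 'b::comm_ring_1"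
  shows "(\<Sum>y<n. (-1) ^ y * (g (Suc y) + g y)) = g 0 - (-1) ^ n * g n"
  by (induction n) (simp_all add: algebra_simps)

section \<open>Factorials and series of radius \<open>p powr (-1 / (p - 1))\<close>\<close>

locale padic_field =
  fixes p :: nat and T :: "'a::ultrametric_field itself"
  assumes prime_p: "prime p"
    and vabs_p: "vabs (of_nat p :: 'a) = 1 / real p"
    and complete_UNIV: "complete (UNIV :: 'a set)"
begin

lemma p_gt_1: "1 < p"
  using prime_p by (rule prime_gt_1_nat)

lemma vabs_p_power: "vabs (of_nat (p ^ N) :: 'a) = (1 / real p) ^ N"
  by (simp add: vabs_power vabs_p)

lemma vabs_p_power_tendsto: "(\<lambda>N. vabs (of_nat (p ^ N) :: 'a)) \<longlonglongrightarrow> 0"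
  unfolding vabs_p_power using p_gt_1 by (intro LIMSEQ_realpow_zero) auto

text \<open>By Bezout, \<open>1\<close> is an integer combination of \<open>p\<close> and
  \<open>n\<close>; if \<open>n\<close> had value below \<open>1\<close>, both summands and hence
  \<open>1\<close> itself would have value below \<open>1\<close>.\<close>

lemma vabs_of_nat_eq_1:
  assumes "\<not> p dvd n"
  shows "vabs (of_nat n :: 'a) = 1"
proof (rule ccontr)
  assume "vabs (of_nat n :: 'a) \<noteq> 1"
  then have n: "vabs (of_nat n :: 'a) < 1"
    using vabs_of_nat_le_1[of n, where 'a='a] by simp
  have "coprime (int p) (int n)"
    using prime_imp_coprime[OF prime_p assms] by simp
  then obtain u v where "u * int p + v * int n = 1"
    using bezout_int[of "int p" "int n"] by (auto simp: coprime_iff_gcd_eq_1)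
  then have "of_int (u * int p + v * int n) = (1::'a)"
    by simp
  then have "1 = vabs (of_int u * of_nat p + of_int v * of_nat n :: 'a)"
    by simp
  also have "\<dots> \<le> max (vabs (of_int u * of_nat p :: 'a)) (vabs (of_int v * of_nat n :: 'a))"
    by (rule vabs_add_le_max)
  also have "\<dots> < 1"
  proof -
    have *: "vabs (of_int k * x :: 'a) < 1" if "vabs x < 1" for k x
      using mult_right_mono[OF vabs_of_int_le_1[of k, where 'a='a] vabs_nonneg[of x]] that
      by (simp add: vabs_mult)
    show ?thesis
      using *[OF n] *[of "of_nat p"] p_gt_1 by (simp add: vabs_p)
  qed
  finally show False by simp
qed

text \<open>Each factor \<open>p\<close> of \<open>n\<close> contributes exactly
  \<open>1 / p\<close>, the cofactor prime to \<open>p\<close> has value \<open>1\<close>, and a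
  power of \<open>p\<close> dividing \<open>n\<close> is at most \<open>n\<close>.\<close>

lemma vabs_of_nat_ge:
  assumes "0 < n"
  shows "1 / real n \<le> vabs (of_nat n :: 'a)"
  using assms
proof (induction n rule: less_induct)
  case (less n)
  show ?case
  proof (cases "p dvd n")
    case True
    then obtain k where k: "n = p * k" by blast
    then have "k < n" "0 < k"
      using less.prems p_gt_1 by auto
    then have "1 / real k \<le> vabs (of_nat k :: 'a)"
      using less.IH by blast
    then have "1 / real p * (1 / real k) \<le> 1 / real p * vabs (of_nat k :: 'a)"
      by (intro mult_left_mono) auto
    then show ?thesis
      by (simp add: k vabs_mult vabs_p)
  next
    case False
    then show ?thesis
      using less.prems by (simp add: vabs_of_nat_eq_1)
  qed
qed

text \<open>The radius of convergence of the exponential series. The estimates rest on its lying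
  strictly between \<open>0\<close> and \<open>1\<close> and on \<open>radius_power\<close>.\<close>

definition radius :: real where
  "radius = real p powr (- 1 / (real p - 1))"

lemma radius_pos: "0 < radius"
  using p_gt_1 by (simp add: radius_def)

lemma radius_less_1: "radius < 1"
  using p_gt_1 by (simp add: radius_def powr_less_one)

lemma radius_power: "radius ^ (p - 1) = 1 / real p"
proof -
  have "radius ^ (p - 1) = radius powr real (p - 1)"
    using radius_pos by (simp add: powr_realpow)
  also have "\<dots> = real p powr (- 1)"
    using p_gt_1 unfolding radius_def by (simp add: powr_powr of_nat_diff)
  finally show ?thesis
    using p_gt_1 by (simp add: powr_minus_divide)
qed

lemma vabs_fact_add:
  assumes "s < p"
  shows "vabs (fact (p * k + s) :: 'a) = vabs (fact (p * k) :: 'a)"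
  using assms
proof (induction s)
  case (Suc s)
  have "\<not> p dvd Suc s"
    using Suc.prems by (simp add: nat_dvd_not_less)
  then have "\<not> p dvd Suc (p * k + s)"
    by (metis add_Suc_right dvd_add_right_iff dvd_triv_left)
  then have "vabs (of_nat (Suc (p * k + s)) :: 'a) = 1"
    by (rule vabs_of_nat_eq_1)
  then show ?case
    using Suc by (simp add: vabs_mult del: of_nat_Suc)
qed simp

text \<open>From \<open>(p * k)!\<close> to \<open>(p * (k + 1))!\<close> only the last factor
  \<open>p * (k + 1)\<close> is divisible by \<open>p\<close>; it yields one more
  \<open>1 / p\<close> and the step from \<open>k!\<close> to \<open>(k + 1)!\<close>.\<close>

lemma vabs_fact_mult: "vabs (fact (p * k) :: 'a) = (1 / real p) ^ k * vabs (fact k :: 'a)"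
proof (induction k)
  case (Suc k)
  have eq: "p * Suc k = Suc (p * k + (p - 1))"
    using p_gt_1 by simp
  have "vabs (fact (p * Suc k) :: 'a) = vabs (of_nat (p * Suc k) * fact (p * k + (p - 1)) :: 'a)"
    by (metis eq fact_Suc)
  also have "\<dots> = vabs (of_nat (p * Suc k) :: 'a) * vabs (fact (p * k) :: 'a)"
    using vabs_fact_add[of "p - 1" k] p_gt_1 by (simp add: vabs_mult)
  also have "\<dots> = (1 / real p) ^ Suc k * vabs (of_nat (Suc k) * fact k :: 'a)"
    unfolding Suc vabs_mult of_nat_mult vabs_p power_Suc by (simp only: mult_ac)
  finally show ?case
    by (simp only: fact_Suc)
qed simp

text \<open>This is Legendre's estimate \<open>v\<^sub>p(n!) \<le> (n - 1) / (p - 1)\<close>.\<close>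

lemma vabs_fact_ge:
  assumes "0 < n"
  shows "radius ^ (n - 1) \<le> vabs (fact n :: 'a)"
  using assms
proof (induction n rule: less_induct)
  case (less n)
  define k where "k = n div p"
  have n: "n = p * k + n mod p"
    by (simp add: k_def)
  have fact_n: "vabs (fact n :: 'a) = (1 / real p) ^ k * vabs (fact k :: 'a)"
    using vabs_fact_add[of "n mod p" k] p_gt_1 n vabs_fact_mult[of k] by simp
  show ?case
  proof (cases "k = 0")
    case True
    then show ?thesis
      using fact_n radius_pos radius_less_1 by (simp add: power_le_one)
  next
    case False
    have "k < n"
      using less.prems p_gt_1 by (simp add: k_def)
    have "p * k = (p - 1) * k + k"
      using p_gt_1 by (simp add: mult_eq_if)
    \<comment> \<open>The exponent is split so that \<open>radius_power\<close> turns the first part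
      into \<open>k\<close> factors \<open>1 / p\<close>, while \<open>k - 1\<close> is the exponent
      in the induction hypothesis for \<open>k\<close>.\<close>
    then have "(p - 1) * k + (k - 1) \<le> n - 1"
      using n False by linarith
    then have "radius ^ (n - 1) \<le> radius ^ ((p - 1) * k + (k - 1))"
      using radius_pos radius_less_1 by (intro power_decreasing) auto
    also have "\<dots> = (1 / real p) ^ k * radius ^ (k - 1)"
      by (simp only: power_add power_mult radius_power)
    also have "\<dots> \<le> (1 / real p) ^ k * vabs (fact k :: 'a)"
      using less.IH[of k] \<open>k < n\<close> False by (intro mult_left_mono) auto
    finally show ?thesis
      by (simp only: fact_n)
  qed
qed

lemma vabs_inverse_fact_le: "vabs (1 / fact (Suc n) :: 'a) \<le> 1 / radius ^ n"
  using vabs_fact_ge[of "Suc n"] radius_pos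
  by (simp add: vabs_divide frac_le del: fact_Suc)

text \<open>As \<open>(n + 1)! = (n + 1) * n!\<close> with \<open>n!\<close> of value at most
  \<open>1\<close>, the bound for factorials carries over to the denominators of the logarithm and
  of the binomial series.\<close>

lemma vabs_divide_Suc_le:
  fixes c :: 'a
  assumes "vabs c \<le> 1"
  shows "vabs (c / of_nat (Suc n)) \<le> 1 / radius ^ n"
proof -
  have "vabs (fact (Suc n) :: 'a) = vabs (of_nat (Suc n) :: 'a) * vabs (of_nat (fact n) :: 'a)"
    by (simp only: fact_Suc vabs_mult of_nat_fact)
  also have "\<dots> \<le> vabs (of_nat (Suc n) :: 'a)"
    using vabs_of_nat_le_1[of "fact n", where 'a='a] by (simp add: mult_left_le del: of_nat_Suc of_nat_fact)
  finally have "radius ^ n \<le> vabs (of_nat (Suc n) :: 'a)"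
    using vabs_fact_ge[of "Suc n"] by simp
  then show ?thesis
    using assms radius_pos by (simp add: vabs_divide frac_le del: of_nat_Suc)
qed

lemma tame_term_bound:
  fixes z :: 'a
  assumes "vabs (a n) \<le> 1 / radius ^ n"
  shows "vabs (a n * z ^ Suc n) \<le> vabs z * (vabs z / radius) ^ n"
  using mult_right_mono[OF assms, of "vabs z ^ Suc n"] radius_pos
  by (simp add: vabs_mult vabs_power power_divide)

lemma ratio_bounds:
  assumes "vabs (z::'a) < radius"
  shows "0 \<le> vabs z / radius" "vabs z / radius < 1"
  using assms radius_pos by auto

text \<open>The terms are dominated by a geometric sequence with ratio
  \<open>vabs z / radius < 1\<close>, and terms tending to \<open>0\<close> suffice for
  convergence.\<close>

lemma tame_series_summable:
  fixes z :: 'a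
  assumes "vabs z < radius" and "\<And>n. vabs (a n) \<le> 1 / radius ^ n"
  shows "summable (\<lambda>n. a n * z ^ Suc n)"
proof (rule summable_of_vabs_bound[OF complete_UNIV tame_term_bound[OF assms(2)]])
  have "(\<lambda>n. vabs z * (vabs z / radius) ^ n) \<longlonglongrightarrow> vabs z * 0"
    using ratio_bounds[OF assms(1)] by (intro tendsto_intros LIMSEQ_realpow_zero)
  then show "(\<lambda>n. vabs z * (vabs z / radius) ^ n) \<longlonglongrightarrow> 0" by simp
qed

text \<open>The exponential, the logarithm and \<open>((1 + z) ^ k - 1) / k\<close> are all of this form.\<close>

lemma tame_series_bound:
  fixes z :: 'a
  assumes z: "vabs z < radius" and a: "\<And>n. vabs (a n) \<le> 1 / radius ^ n" and "a 0 = 1"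
    and sums: "(\<lambda>n. a n * z ^ Suc n) sums s"
  shows "vabs (s - z) \<le> (vabs z)\<^sup>2 / radius" and "vabs s = vabs z"
proof -
  have "(\<lambda>n. a (Suc n) * z ^ Suc (Suc n)) sums (s - z)"
  proof -
    have "(\<lambda>n. (\<Sum>i<Suc n. a i * z ^ Suc i) - z) \<longlonglongrightarrow> s - z"
      by (rule tendsto_diff[OF LIMSEQ_Suc[OF sums[unfolded sums_def]] tendsto_const])
    then show ?thesis
      using \<open>a 0 = 1\<close> by (simp add: sums_def sum.lessThan_Suc_shift del: sum.lessThan_Suc)
  qed
  \<comment> \<open>With the leading term \<open>z\<close> removed, every term carries at least one
    factor \<open>vabs z / radius\<close>; the remainder is thus quadratic in \<open>z\<close> and,
    for nonzero \<open>z\<close>, strictly smaller than \<open>z\<close>.\<close>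
  moreover have "vabs (a (Suc n) * z ^ Suc (Suc n)) \<le> (vabs z)\<^sup>2 / radius" for n
  proof -
    have "vabs (a (Suc n) * z ^ Suc (Suc n)) \<le> vabs z * (vabs z / radius) ^ Suc n"
      by (rule tame_term_bound[OF a])
    also have "\<dots> \<le> vabs z * (vabs z / radius) ^ 1"
      using ratio_bounds[OF z] by (intro mult_left_mono power_decreasing) auto
    finally show ?thesis
      by (simp add: power2_eq_square)
  qed
  ultimately show le: "vabs (s - z) \<le> (vabs z)\<^sup>2 / radius"
    by (rule sums_vabs_bound)
  show "vabs s = vabs z"
  proof (cases "z = 0")
    case True
    then show ?thesis using le by simp
  next
    case False
    then have "vabs z * (vabs z / radius) < vabs z * 1"
      using ratio_bounds[OF z] by (intro mult_strict_left_mono) auto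
    then show ?thesis
      using le by (intro vabs_eq_of_diff_less) (simp add: power2_eq_square)
  qed
qed

section \<open>Powers of principal units\<close>

text \<open>The absorption identity
  \<open>(n + 1) * (k choose (n + 1)) = k * ((k - 1) choose n)\<close> allows the binomial expansion
  to be divided by \<open>k\<close>; the leading coefficient becomes \<open>1\<close>, and the terms
  with \<open>n \<ge> k\<close> vanish.\<close>

lemma power_minus_1_sums:
  fixes z :: 'a
  assumes "0 < k"
  shows "(\<lambda>n. of_nat ((k - 1) choose n) / of_nat (Suc n) * z ^ Suc n) sums (((1 + z) ^ k - 1) / of_nat k)"
proof -
  have "(\<lambda>n. of_nat ((k - 1) choose n) / of_nat (Suc n) * z ^ Suc n) sums
      (\<Sum>n<k. of_nat ((k - 1) choose n) / of_nat (Suc n) * z ^ Suc n)"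
    using assms by (intro sums_finite) (auto simp: binomial_eq_0)
  moreover have "(\<Sum>n<k. of_nat ((k - 1) choose n) / of_nat (Suc n) * z ^ Suc n) = ((1 + z) ^ k - 1) / of_nat k"
  proof -
    have "(z + 1) ^ k = (\<Sum>j<Suc k. of_nat (k choose j) * z ^ j)"
      by (simp add: binomial_ring lessThan_Suc_atMost)
    also have "\<dots> = 1 + (\<Sum>j<k. of_nat (k choose Suc j) * z ^ Suc j)"
      by (subst sum.lessThan_Suc_shift) simp
    also have "(\<Sum>j<k. of_nat (k choose Suc j) * z ^ Suc j)
        = of_nat k * (\<Sum>n<k. of_nat ((k - 1) choose n) / of_nat (Suc n) * z ^ Suc n)"
      unfolding sum_distrib_left
    proof (rule sum.cong[OF refl])
      fix j
      have "of_nat (Suc j) * of_nat (k choose Suc j) = (of_nat k * of_nat ((k - 1) choose j) :: 'a)"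
        by (metis binomial_absorption of_nat_mult)
      then have "of_nat (k choose Suc j) = (of_nat k * of_nat ((k - 1) choose j) / of_nat (Suc j) :: 'a)"
        by (metis mult.commute nonzero_eq_divide_eq of_nat_neq_0)
      then show "of_nat (k choose Suc j) * z ^ Suc j
          = of_nat k * (of_nat ((k - 1) choose j) / of_nat (Suc j) * z ^ Suc j)"
        by simp
    qed
    finally show ?thesis
      using assms by (simp add: add.commute)
  qed
  ultimately show ?thesis by simp
qed

text \<open>The leading term dominates the series of \<open>((1 + z) ^ k - 1) / k\<close>. The lower
  bound contained in this equality is what forces \<open>v = 1\<close> in
  \<open>padic_exp_log\<close>.\<close>

lemma vabs_power_minus_1:
  fixes u :: 'a
  assumes "vabs (u - 1) < radius"
  shows "vabs (u ^ k - 1) = vabs (of_nat k :: 'a) * vabs (u - 1)"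
proof (cases "k = 0")
  case False
  define z where "z = u - 1"
  have "vabs (((1 + z) ^ k - 1) / of_nat k) = vabs z"
    using assms False
    by (intro tame_series_bound(2)[OF _ _ _ power_minus_1_sums] vabs_divide_Suc_le vabs_of_nat_le_1)
      (auto simp: z_def)
  then show ?thesis
    using False by (simp add: z_def vabs_divide field_simps)
qed simp

lemma vabs_principal_unit:
  fixes u :: 'a
  assumes "vabs (u - 1) < radius"
  shows "vabs u = 1"
  using vabs_eq_of_diff_less[of u 1] assms radius_less_1 by simp

lemma principal_unit_nonzero: "vabs (u - 1 :: 'a) < radius \<Longrightarrow> u \<noteq> 0"
  using vabs_principal_unit by fastforce

lemma vabs_inverse_minus_1:
  fixes u :: 'a
  assumes "vabs (u - 1) < radius"
  shows "vabs (inverse u - 1) = vabs (u - 1)"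
proof -
  have "inverse u - 1 = - ((u - 1) / u)"
    using principal_unit_nonzero[OF assms] by (simp add: field_simps)
  then show ?thesis
    using vabs_principal_unit[OF assms] by (simp only: vabs_minus vabs_divide div_by_1)
qed

text \<open>The factor \<open>k\<close> has value at most \<open>1\<close>. It ranges over all
  integers because \<open>h\<close> may be negative; negative exponents are moved to
  \<open>inverse u\<close>, which is equally close to \<open>1\<close>.\<close>

lemma vabs_powi_minus_1_le:
  fixes u :: 'a
  assumes "vabs (u - 1) < radius"
  shows "vabs (u powi (k * int n) - 1) \<le> vabs (of_nat n :: 'a)"
proof -
  have *: "vabs (u ^ (i * n) - 1) \<le> vabs (of_nat n :: 'a)" if "vabs (u - 1) < radius" for i and u :: 'a
  proof -
    have "vabs (of_nat i :: 'a) * vabs (u - 1) \<le> 1 * 1"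
      using vabs_of_nat_le_1 that radius_less_1 by (intro mult_mono) auto
    then have "vabs (of_nat n :: 'a) * (vabs (of_nat i :: 'a) * vabs (u - 1)) \<le> vabs (of_nat n :: 'a) * 1"
      by (intro mult_left_mono) auto
    then show ?thesis
      using vabs_power_minus_1[OF that, of "i * n"] by (simp add: vabs_mult mult_ac)
  qed
  show ?thesis
  proof (cases k rule: int_cases2)
    case (nonneg i)
    then show ?thesis
      using *[OF assms, of i] by (simp flip: of_nat_mult)
  next
    case (nonpos i)
    then have "k * int n = - int (i * n)" by simp
    then have "u powi (k * int n) = inverse u ^ (i * n)"
      by (simp only: power_int_minus power_int_of_nat power_inverse)
    then show ?thesis
      using *[of "inverse u" i] vabs_inverse_minus_1[OF assms] assms by simp
  qed
qed

lemma power_p_power_tendsto_1: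
  fixes u :: 'a
  assumes "vabs (u - 1) < radius"
  shows "(\<lambda>N. u ^ p ^ N) \<longlonglongrightarrow> 1"
  using vabs_powi_minus_1_le[OF assms, of 1]
  by (intro tendsto_vabs_bound[OF _ vabs_p_power_tendsto]) (simp only: mult_1 power_int_of_nat)

section \<open>The exponential and the logarithm\<close>

text \<open>Removing the constant term \<open>1\<close> brings the exponential into the shape
  \<open>a n * z ^ Suc n\<close> of the general series.\<close>

lemma padic_exp_minus_1_sums:
  fixes z :: 'a
  assumes "vabs z < radius"
  shows "(\<lambda>n. 1 / fact (Suc n) * z ^ Suc n) sums (padic_exp z - 1)"
    and "(\<lambda>n. z ^ n / fact n) sums padic_exp z"
proof -
  obtain s where s: "(\<lambda>n. 1 / fact (Suc n) * z ^ Suc n) sums s"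
    using tame_series_summable[OF assms vabs_inverse_fact_le] by (auto simp: summable_def)
  have "(\<lambda>n. (\<Sum>i<n. 1 / fact (Suc i) * z ^ Suc i) + 1) \<longlonglongrightarrow> s + 1"
    by (rule tendsto_add[OF s[unfolded sums_def] tendsto_const])
  then have "(\<lambda>n. \<Sum>i<Suc n. z ^ i / fact i) \<longlonglongrightarrow> s + 1"
    by (simp add: sum.lessThan_Suc_shift add.commute del: sum.lessThan_Suc fact_Suc)
  then have exp: "(\<lambda>n. z ^ n / fact n) sums (s + 1)"
    unfolding sums_def by (rule LIMSEQ_imp_Suc)
  then have "padic_exp z = s + 1"
    unfolding padic_exp_def by (rule sums_unique[symmetric])
  then show "(\<lambda>n. 1 / fact (Suc n) * z ^ Suc n) sums (padic_exp z - 1)"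
    and "(\<lambda>n. z ^ n / fact n) sums padic_exp z"
    using s exp by simp_all
qed

lemma vabs_padic_exp:
  fixes z :: 'a
  assumes "vabs z < radius"
  shows "vabs (padic_exp z - 1 - z) \<le> (vabs z)\<^sup>2 / radius"
    and "vabs (padic_exp z - 1) = vabs z"
  using tame_series_bound[OF assms vabs_inverse_fact_le _ padic_exp_minus_1_sums(1)[OF assms]]
  by simp_all

lemma padic_exp_0 [simp]: "padic_exp (0::'a) = 1"
  using vabs_padic_exp(2)[of 0] radius_pos by simp

lemma vabs_exp_term_le:
  fixes z :: 'a
  assumes "vabs z \<le> d * radius"
  shows "vabs (z ^ n / fact n) \<le> d ^ n"
proof (cases n)
  case (Suc k)
  have d: "0 \<le> d"
    using assms radius_pos vabs_nonneg[of z] by (meson mult_less_cancel_right_disj order_trans zero_le_mult_iff not_less)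
  have "vabs (z ^ n / fact n) = vabs (1 / fact (Suc k) * z ^ Suc k)"
    by (simp add: Suc)
  also have "\<dots> \<le> vabs z * (vabs z / radius) ^ k"
    by (rule tame_term_bound[OF vabs_inverse_fact_le])
  also have "\<dots> \<le> d * d ^ k"
  proof (intro mult_mono power_mono)
    show "vabs z / radius \<le> d"
      using assms radius_pos by (simp add: field_simps)
    show "vabs z \<le> d"
      using assms d radius_less_1 mult_left_le[of radius d] by simp
  qed (use d radius_pos in auto)
  finally show ?thesis
    by (simp add: Suc)
qed simp

text \<open>The product of partial sums runs over a square of index pairs, the partial sum at
  \<open>x + y\<close> over the triangle \<open>i + j < n\<close>. The terms in between have value
  at most \<open>d ^ n\<close>, and by the ultrametric inequality so has their sum.\<close>

lemma padic_exp_add: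
  fixes x y :: 'a
  assumes x: "vabs x < radius" and y: "vabs y < radius"
  shows "padic_exp (x + y) = padic_exp x * padic_exp y"
proof -
  define d where "d = max (vabs x) (vabs y) / radius"
  have d: "0 \<le> d" "d < 1" "vabs x \<le> d * radius" "vabs y \<le> d * radius"
    using x y radius_pos by (auto simp: d_def le_max_iff_disj)
  have xy: "vabs (x + y) < radius"
    using vabs_add_le_max[of x y] x y by simp
  define E where "E z n = (\<Sum>i<n. z ^ i / fact i)" for z :: 'a and n
  have E: "E z \<longlonglongrightarrow> padic_exp z" if "vabs z < radius" for z
    using padic_exp_minus_1_sums(2)[OF that] by (simp add: sums_def E_def[abs_def])
  have bound: "vabs (E x n * E y n - E (x + y) n) \<le> d ^ n" for n
  proof -
    define g where "g = (\<lambda>(i, j). (x ^ i / fact i) * (y ^ j / fact j))"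
    have "E (x + y) n = (\<Sum>k<n. \<Sum>i\<le>k. g (i, k - i))"
      unfolding E_def
    proof (rule sum.cong[OF refl])
      fix k
      have "(x + y) ^ k / fact k = (\<Sum>i\<le>k. of_nat (k choose i) * x ^ i * y ^ (k - i) / fact k)"
        by (simp add: binomial_ring sum_divide_distrib)
      also have "\<dots> = (\<Sum>i\<le>k. g (i, k - i))"
        by (rule sum.cong) (simp_all add: g_def binomial_fact)
      finally show "(x + y) ^ k / fact k = (\<Sum>i\<le>k. g (i, k - i))" .
    qed
    also have "\<dots> = sum g {(i, j). i + j < n}"
      using sum.triangle_reindex[of "\<lambda>i j. g (i, j)" n] by simp
    finally have sum: "E (x + y) n = sum g {(i, j). i + j < n}" .
    have "E x n * E y n = sum g ({..<n} \<times> {..<n})"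
      by (simp add: E_def g_def sum_product sum.cartesian_product)
    then have "E x n * E y n - E (x + y) n = sum g ({..<n} \<times> {..<n} - {(i, j). i + j < n})"
      unfolding sum by (subst sum_diff) auto
    also have "vabs \<dots> \<le> d ^ n"
    proof (rule vabs_sum_le)
      fix t
      assume "t \<in> {..<n} \<times> {..<n} - {(i, j). i + j < n}"
      then obtain i j where t: "t = (i, j)" "n \<le> i + j" by force
      have "vabs (x ^ i / fact i) * vabs (y ^ j / fact j) \<le> d ^ i * d ^ j"
        using d by (intro mult_mono vabs_exp_term_le) auto
      also have "\<dots> \<le> d ^ n"
        unfolding power_add[symmetric] using d t by (intro power_decreasing) auto
      finally show "vabs (g t) \<le> d ^ n"
        by (simp only: g_def t vabs_mult prod.case)
    qed (use d in simp)
    finally show ?thesis .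
  qed
  have "(\<lambda>n. E x n * E y n - E (x + y) n) \<longlonglongrightarrow> 0"
    by (rule tendsto_vabs_bound[where g = "\<lambda>n. d ^ n"])
      (use bound d in \<open>auto intro: LIMSEQ_realpow_zero\<close>)
  moreover have "(\<lambda>n. E x n * E y n - E (x + y) n) \<longlonglongrightarrow> padic_exp x * padic_exp y - padic_exp (x + y)"
    by (intro tendsto_diff tendsto_mult E x y xy)
  ultimately show ?thesis
    using LIMSEQ_unique by fastforce
qed

lemma padic_exp_uminus:
  fixes z :: 'a
  assumes "vabs z < radius"
  shows "padic_exp (- z) = inverse (padic_exp z)"
proof -
  have "padic_exp z * padic_exp (- z) = 1"
    using padic_exp_add[of z "- z"] assms by simp
  then show ?thesis
    by (simp add: inverse_unique)
qed

lemma padic_exp_of_nat_mult: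
  fixes z :: 'a
  assumes "vabs z < radius"
  shows "padic_exp (of_nat n * z) = padic_exp z ^ n"
proof (induction n)
  case (Suc n)
  have "vabs (of_nat n * z) \<le> vabs z"
    using vabs_of_nat_le_1[of n, where 'a='a] by (simp add: vabs_mult mult_left_le_one_le)
  then show ?case
    using padic_exp_add[of z "of_nat n * z"] assms Suc by (simp add: algebra_simps)
qed simp

lemma padic_exp_of_int_mult:
  fixes z :: 'a
  assumes "vabs z < radius"
  shows "padic_exp (of_int k * z) = padic_exp z powi k"
proof (cases k rule: int_cases2)
  case (nonneg n)
  then show ?thesis
    using padic_exp_of_nat_mult[OF assms] by simp
next
  case (nonpos n)
  have "vabs (of_nat n * z) \<le> vabs z"
    using vabs_of_nat_le_1[of n, where 'a='a] by (simp add: vabs_mult mult_left_le_one_le)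
  then have "padic_exp (- (of_nat n * z)) = inverse (padic_exp (of_nat n * z))"
    using assms by (intro padic_exp_uminus) simp
  then show ?thesis
    using padic_exp_of_nat_mult[OF assms] nonpos by (simp add: power_int_minus)
qed

text \<open>Here \<open>padic_exp (x - y) = 1\<close>, and
  \<open>vabs (padic_exp z - 1) = vabs z\<close> leaves only \<open>x - y = 0\<close>.\<close>

lemma padic_exp_inj:
  fixes x y :: 'a
  assumes "vabs x < radius" and "vabs y < radius" and "padic_exp x = padic_exp y"
  shows "x = y"
proof -
  have less: "vabs (x - y) < radius"
    using vabs_diff_le_max[of x y] assms by simp
  have "padic_exp y \<noteq> 0"
    using vabs_padic_exp(2)[OF assms(2)] assms(2) radius_less_1 by auto
  moreover have "padic_exp x = padic_exp (x - y) * padic_exp y"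
    using padic_exp_add[OF less assms(2)] by simp
  ultimately have "padic_exp (x - y) = 1"
    using assms(3) by simp
  then show ?thesis
    using vabs_padic_exp(2)[OF less] by simp
qed

section \<open>The logarithm and its inversion by the exponential\<close>

lemma padic_log_sums:
  fixes u :: 'a
  assumes "vabs (u - 1) < radius"
  shows "(\<lambda>n. (-1) ^ n / of_nat (Suc n) * (u - 1) ^ Suc n) sums padic_log u"
proof -
  have "summable (\<lambda>n. (-1) ^ n / of_nat (Suc n) * (u - 1) ^ Suc n)"
    using assms by (intro tame_series_summable vabs_divide_Suc_le) (simp_all add: vabs_power)
  then show ?thesis
    by (simp add: padic_log_def summable_sums del: of_nat_Suc power_Suc)
qed

lemma vabs_padic_log:
  fixes u :: 'a
  assumes "vabs (u - 1) < radius"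
  shows "vabs (padic_log u - (u - 1)) \<le> (vabs (u - 1))\<^sup>2 / radius"
    and "vabs (padic_log u) = vabs (u - 1)"
  using tame_series_bound[OF assms vabs_divide_Suc_le _ padic_log_sums[OF assms]]
  by (simp_all add: vabs_power)

text \<open>By Pascal's rule the error at \<open>j + 1\<close> is \<open>k choose (j + 1)\<close>
  minus the error at \<open>j\<close>; absorption and \<open>vabs_of_nat_ge\<close> bound the
  binomial coefficient by \<open>vabs (of_nat k) * real (Suc j)\<close>.\<close>

lemma vabs_binomial_minus_sign_le:
  assumes "0 < k"
  shows "vabs (of_nat ((k - 1) choose j) - (-1) ^ j :: 'a) \<le> vabs (of_nat k :: 'a) * real j"
proof (induction j)
  case (Suc j)
  have "of_nat (k choose Suc j) = (of_nat ((k - 1) choose j) + of_nat ((k - 1) choose Suc j) :: 'a)"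
    using assms by (cases k) simp_all
  then have eq: "of_nat ((k - 1) choose Suc j) - (-1) ^ Suc j
      = of_nat (k choose Suc j) - (of_nat ((k - 1) choose j) - (-1) ^ j :: 'a)"
    by simp
  have "vabs (of_nat (Suc j) :: 'a) * vabs (of_nat (k choose Suc j) :: 'a)
      = vabs (of_nat k :: 'a) * vabs (of_nat ((k - 1) choose j) :: 'a)"
    by (metis binomial_absorption of_nat_mult vabs_mult)
  also have "\<dots> \<le> vabs (of_nat k :: 'a)"
    by (intro mult_left_le vabs_of_nat_le_1 vabs_nonneg)
  finally have "vabs (of_nat (Suc j) :: 'a) * vabs (of_nat (k choose Suc j) :: 'a) \<le> vabs (of_nat k :: 'a)" .
  moreover have "1 / real (Suc j) * vabs (of_nat (k choose Suc j) :: 'a)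
      \<le> vabs (of_nat (Suc j) :: 'a) * vabs (of_nat (k choose Suc j) :: 'a)"
    by (intro mult_right_mono vabs_of_nat_ge) simp_all
  ultimately have "1 / real (Suc j) * vabs (of_nat (k choose Suc j) :: 'a) \<le> vabs (of_nat k :: 'a)"
    by linarith
  then have "vabs (of_nat (k choose Suc j) :: 'a) \<le> vabs (of_nat k :: 'a) * real (Suc j)"
    by (simp add: field_simps)
  moreover have "vabs (of_nat ((k - 1) choose j) - (-1) ^ j :: 'a) \<le> vabs (of_nat k :: 'a) * real (Suc j)"
    using Suc mult_left_mono[of "real j" "real (Suc j)" "vabs (of_nat k :: 'a)"] by simp
  ultimately show ?case
    unfolding eq
    using vabs_diff_le_max[of "of_nat (k choose Suc j) :: 'a" "of_nat ((k - 1) choose j) - (-1) ^ j"]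
    by (meson max.boundedI order_trans)
qed simp

text \<open>The series of \<open>((1 + z) ^ k - 1) / k\<close> and of the logarithm are compared
  term by term with \<open>vabs_binomial_minus_sign_le\<close>. As \<open>n * d ^ n\<close> is
  bounded, they differ by at most a constant multiple of the value of \<open>k\<close>, which tends
  to \<open>0\<close> along the powers of \<open>p\<close>.\<close>

lemma padic_log_limit:
  fixes u :: 'a
  assumes "vabs (u - 1) < radius"
  shows "(\<lambda>N. (u ^ p ^ N - 1) / of_nat (p ^ N)) \<longlonglongrightarrow> padic_log u"
proof -
  define z where "z = u - 1"
  define d where "d = vabs z / radius"
  have z: "vabs z < radius" and d: "0 \<le> d" "d < 1"
    using assms ratio_bounds[OF assms] by (simp_all add: z_def d_def)
  have "(\<lambda>n. real n * d ^ n) \<longlonglongrightarrow> 0"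
    using d by (intro powser_times_n_limit_0) simp
  then have "Bseq (\<lambda>n. real n * d ^ n)"
    by (intro convergent_imp_Bseq convergentI)
  then obtain K where K: "\<And>n. norm (real n * d ^ n) \<le> K"
    by (meson BseqE)
  have "vabs ((u ^ k - 1) / of_nat k - padic_log u) \<le> vabs (of_nat k :: 'a) * K" if "0 < k" for k
  proof -
    let ?c = "\<lambda>n. of_nat ((k - 1) choose n) - (-1) ^ n :: 'a"
    have "(\<lambda>n. \<Sum>i<n. of_nat ((k - 1) choose i) / of_nat (Suc i) * z ^ Suc i) \<longlonglongrightarrow> (u ^ k - 1) / of_nat k"
      using power_minus_1_sums[OF that, of z] by (simp add: sums_def z_def)
    moreover have "(\<lambda>n. \<Sum>i<n. (-1) ^ i / of_nat (Suc i) * z ^ Suc i) \<longlonglongrightarrow> padic_log u"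
      using padic_log_sums[OF assms] by (simp add: sums_def z_def)
    ultimately have "(\<lambda>n. (\<Sum>i<n. of_nat ((k - 1) choose i) / of_nat (Suc i) * z ^ Suc i)
        - (\<Sum>i<n. (-1) ^ i / of_nat (Suc i) * z ^ Suc i)) \<longlonglongrightarrow> (u ^ k - 1) / of_nat k - padic_log u"
      by (rule tendsto_diff)
    then have "(\<lambda>n. ?c n * (1 / of_nat (Suc n) * z ^ Suc n)) sums ((u ^ k - 1) / of_nat k - padic_log u)"
      unfolding sums_def
      by (simp add: sum_subtractf[symmetric] diff_divide_distrib left_diff_distrib
          del: of_nat_Suc power_Suc)
    then show ?thesis
    proof (rule sums_vabs_bound)
      fix n
      have "vabs (?c n * (1 / of_nat (Suc n) * z ^ Suc n))
          \<le> (vabs (of_nat k :: 'a) * real n) * (vabs z * d ^ n)"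
        unfolding vabs_mult[of "?c n"] d_def
        by (intro mult_mono vabs_binomial_minus_sign_le that tame_term_bound vabs_divide_Suc_le) simp_all
      also have "\<dots> = vabs (of_nat k :: 'a) * (vabs z * (real n * d ^ n))"
        by simp
      also have "\<dots> \<le> vabs (of_nat k :: 'a) * (1 * K)"
        using z radius_less_1 K[of n] d by (intro mult_left_mono mult_mono) auto
      finally show "vabs (?c n * (1 / of_nat (Suc n) * z ^ Suc n)) \<le> vabs (of_nat k :: 'a) * K"
        by simp
    qed
  qed
  then have "vabs ((u ^ p ^ N - 1) / of_nat (p ^ N) - padic_log u) \<le> vabs (of_nat (p ^ N) :: 'a) * K" for N
    using p_gt_1 by (simp del: of_nat_power)
  moreover have "(\<lambda>N. vabs (of_nat (p ^ N) :: 'a) * K) \<longlonglongrightarrow> 0"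
    using tendsto_mult_left_zero[OF vabs_p_power_tendsto] .
  ultimately show ?thesis
    by (rule tendsto_vabs_bound)
qed

lemma vabs_power_minus_1_less:
  fixes u :: 'a
  assumes "vabs (u - 1) < radius"
  shows "vabs (u ^ k - 1) < radius"
proof -
  have "vabs (of_nat k :: 'a) * vabs (u - 1) \<le> vabs (u - 1)"
    using vabs_of_nat_le_1[of k, where 'a='a] by (simp add: mult_left_le_one_le)
  then show ?thesis
    using vabs_power_minus_1[OF assms, of k] assms by simp
qed

text \<open>The quotients converging to \<open>padic_log (u ^ p ^ M)\<close> are
  \<open>p ^ M\<close> times a tail of those converging to \<open>padic_log u\<close>.\<close>

lemma padic_log_power_p:
  fixes u :: 'a
  assumes "vabs (u - 1) < radius"
  shows "padic_log (u ^ p ^ M) = of_nat (p ^ M) * padic_log u"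
proof -
  have "(\<lambda>N. (u ^ p ^ (N + M) - 1) / of_nat (p ^ (N + M))) \<longlonglongrightarrow> padic_log u"
    by (rule LIMSEQ_ignore_initial_segment[OF padic_log_limit[OF assms]])
  then have "(\<lambda>N. of_nat (p ^ M) * ((u ^ p ^ (N + M) - 1) / of_nat (p ^ (N + M)))) \<longlonglongrightarrow> of_nat (p ^ M) * padic_log u"
    by (intro tendsto_mult tendsto_const)
  moreover have "of_nat (p ^ M) * ((u ^ p ^ (N + M) - 1) / of_nat (p ^ (N + M)))
      = ((u ^ p ^ M) ^ p ^ N - 1) / of_nat (p ^ N)" for N
    using p_gt_1 by (simp add: power_add mult.commute flip: power_mult)
  ultimately have "(\<lambda>N. ((u ^ p ^ M) ^ p ^ N - 1) / of_nat (p ^ N)) \<longlonglongrightarrow> of_nat (p ^ M) * padic_log u"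
    by simp
  then show ?thesis
    using LIMSEQ_unique padic_log_limit[OF vabs_power_minus_1_less[OF assms]] by blast
qed

text \<open>
  The quotient \<open>v = exp (log u) / u\<close> satisfies \<open>|v ^ P - 1| = |P| |v - 1|\<close> for \<open>P = p ^ N\<close>,
  while the quadratic estimates at \<open>u ^ P\<close>, which is within \<open>|P|\<close> of \<open>1\<close>,
  give \<open>|v ^ P - 1| = O(|P|\<^sup>2)\<close>. Hence \<open>v = 1\<close>.
\<close>

lemma padic_exp_log:
  fixes u :: 'a
  assumes u: "vabs (u - 1) < radius"
  shows "padic_exp (padic_log u) = u"
proof -
  define e where "e = padic_exp (padic_log u)"
  define v where "v = e / u"
  have log: "vabs (padic_log u) < radius"
    using u vabs_padic_log(2)[OF u] by simp
  have "vabs (e - 1) < radius"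
    using vabs_padic_exp(2)[OF log] log by (simp add: e_def)
  then have "vabs (e - u) < radius"
    using vabs_diff_le_max[of "e - 1" "u - 1"] u by simp
  moreover have nz: "u \<noteq> 0" and u1: "vabs u = 1"
    using principal_unit_nonzero[OF u] vabs_principal_unit[OF u] by auto
  ultimately have v: "vabs (v - 1) < radius"
    by (simp add: v_def divide_diff_eq_iff vabs_divide)
  have bound: "vabs (v - 1) \<le> radius * vabs (of_nat (p ^ N) :: 'a)" for N
  proof -
    define P where "P = p ^ N"
    define w where "w = u ^ P - 1"
    have P: "0 < vabs (of_nat P :: 'a)"
      using p_gt_1 by (simp add: P_def)
    have w: "vabs w = vabs (of_nat P :: 'a) * vabs (u - 1)"
      using vabs_power_minus_1[OF u] by (simp add: w_def)
    have w_less: "vabs (u ^ P - 1) < radius"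
      by (rule vabs_power_minus_1_less[OF u])
    define l where "l = padic_log (u ^ P)"
    have l: "vabs l = vabs w" "vabs (l - w) \<le> (vabs w)\<^sup>2 / radius"
      using vabs_padic_log[OF w_less] by (simp_all add: l_def w_def)
    have "e ^ P = padic_exp l"
      using padic_exp_of_nat_mult[OF log, of P] padic_log_power_p[OF u, of N]
      by (simp add: e_def l_def P_def)
    \<comment> \<open>The linear terms cancel and leave the quadratic remainders of the exponential
      at \<open>l\<close> and of the logarithm at \<open>u ^ P = 1 + w\<close>.\<close>
    then have "e ^ P - u ^ P = (padic_exp l - 1 - l) + (l - w)"
      by (simp add: w_def)
    also have "vabs \<dots> \<le> max (vabs (padic_exp l - 1 - l)) (vabs (l - w))"
      by (rule vabs_add_le_max)
    also have "\<dots> \<le> (vabs w)\<^sup>2 / radius"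
      using vabs_padic_exp(1)[of l] l w_less by (simp add: w_def)
    finally have "vabs (e ^ P - u ^ P) \<le> (vabs w)\<^sup>2 / radius" .
    moreover have "vabs (v ^ P - 1) = vabs (e ^ P - u ^ P)"
      using nz u1 by (simp add: v_def power_divide divide_diff_eq_iff vabs_divide vabs_power)
    ultimately have "vabs (of_nat P :: 'a) * vabs (v - 1) \<le> (vabs w)\<^sup>2 / radius"
      using vabs_power_minus_1[OF v, of P] by simp
    also have "\<dots> = vabs (of_nat P :: 'a) * (vabs (of_nat P :: 'a) * ((vabs (u - 1))\<^sup>2 / radius))"
      unfolding w by (simp add: power2_eq_square)
    \<comment> \<open>Cancelling one factor from a bound with the square of the value of
      \<open>P\<close> leaves a bound that still tends to \<open>0\<close>.\<close>
    finally have "vabs (v - 1) \<le> vabs (of_nat P :: 'a) * ((vabs (u - 1))\<^sup>2 / radius)"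
      using P by (simp only: mult_le_cancel_left_pos)
    also have "\<dots> \<le> vabs (of_nat P :: 'a) * radius"
    proof (intro mult_left_mono)
      have "(vabs (u - 1))\<^sup>2 \<le> radius\<^sup>2"
        using u by (intro power_mono) auto
      then show "(vabs (u - 1))\<^sup>2 / radius \<le> radius"
        using radius_pos by (simp add: power2_eq_square field_simps)
    qed simp
    finally show ?thesis
      by (simp add: P_def mult.commute)
  qed
  have "vabs (v - 1) \<le> 0"
    using LIMSEQ_le_const[OF tendsto_mult_right_zero[OF vabs_p_power_tendsto]] bound by blast
  then show ?thesis
    using nz by (simp add: v_def e_def)
qed

text \<open>Both sides lie in the disc where the exponential is injective, and it maps both to
  \<open>inverse u\<close>.\<close>

lemma padic_log_inverse:
  fixes u :: 'a
  assumes "vabs (u - 1) < radius"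
  shows "padic_log (inverse u) = - padic_log u"
proof (rule padic_exp_inj)
  have inv: "vabs (inverse u - 1) < radius"
    using assms by (simp add: vabs_inverse_minus_1)
  show "vabs (padic_log (inverse u)) < radius" and less: "vabs (- padic_log u) < radius"
    using vabs_padic_log(2)[OF inv] vabs_padic_log(2)[OF assms] inv assms by simp_all
  show "padic_exp (padic_log (inverse u)) = padic_exp (- padic_log u)"
    using padic_exp_uminus[of "padic_log u"] less padic_exp_log[OF inv] padic_exp_log[OF assms]
    by simp
qed

section \<open>Powers with \<open>p\<close>-adic exponents and \<open>q\<close>-numbers\<close>

lemma vabs_mult_padic_log:
  fixes u x :: 'a
  assumes "vabs (u - 1) < radius" and "vabs x \<le> 1"
  shows "vabs (x * padic_log u) = vabs x * vabs (u - 1)" and "vabs (x * padic_log u) < radius"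
proof -
  show eq: "vabs (x * padic_log u) = vabs x * vabs (u - 1)"
    using vabs_padic_log(2)[OF assms(1)] by (simp add: vabs_mult)
  have "vabs x * vabs (u - 1) \<le> vabs (u - 1)"
    using assms(2) by (simp add: mult_left_le_one_le)
  then show "vabs (x * padic_log u) < radius"
    using eq assms(1) by simp
qed

lemma padic_pow_add:
  fixes u x y :: 'a
  assumes "vabs (u - 1) < radius" and "vabs x \<le> 1" and "vabs y \<le> 1"
  shows "padic_pow u (x + y) = padic_pow u x * padic_pow u y"
  using padic_exp_add vabs_mult_padic_log(2)[OF assms(1)] assms(2,3)
  by (simp add: padic_pow_def distrib_right)

lemma padic_pow_of_int:
  fixes u :: 'a
  assumes "vabs (u - 1) < radius"
  shows "padic_pow u (of_int k) = u powi k"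
  using padic_exp_of_int_mult[of "padic_log u" k] vabs_padic_log(2)[OF assms] assms
    padic_exp_log[OF assms] by (simp add: padic_pow_def)

lemma padic_pow_inverse_uminus:
  fixes u x :: 'a
  assumes "vabs (u - 1) < radius"
  shows "padic_pow (inverse u) (- x) = padic_pow u x"
  using padic_log_inverse[OF assms] by (simp add: padic_pow_def)

lemma vabs_padic_pow:
  fixes u x :: 'a
  assumes "vabs (u - 1) < radius" and "vabs x \<le> 1"
  shows "vabs (padic_pow u x - 1) = vabs x * vabs (u - 1)" and "vabs (padic_pow u x) = 1"
proof -
  show eq: "vabs (padic_pow u x - 1) = vabs x * vabs (u - 1)"
    using vabs_padic_exp(2)[OF vabs_mult_padic_log(2)[OF assms]] vabs_mult_padic_log(1)[OF assms]
    by (simp add: padic_pow_def)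
  then show "vabs (padic_pow u x) = 1"
    using vabs_mult_padic_log[OF assms] by (intro vabs_principal_unit) simp
qed

lemma padic_pow_1 [simp]: "padic_pow 1 (x::'a) = 1"
  by (simp add: padic_pow_def padic_log_def)

text \<open>Writing \<open>X\<close>, \<open>Y\<close> for the powers of \<open>u\<close> at
  \<open>x\<close>, \<open>y\<close>, this is \<open>1 - X * Y = (1 - X) + X * (1 - Y)\<close>
  divided by \<open>1 - u\<close>; for \<open>u = 1\<close> it is plain addition.\<close>

lemma qnumber_add:
  fixes u x y :: 'a
  assumes "vabs (u - 1) < radius" and "vabs x \<le> 1" and "vabs y \<le> 1"
  shows "qnumber u (x + y) = qnumber u x + padic_pow u x * qnumber u y"
  using padic_pow_add[OF assms]
  by (simp add: qnumber_def right_diff_distrib diff_divide_distrib)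

lemma vabs_qnumber:
  fixes u x :: 'a
  assumes "vabs (u - 1) < radius" and "vabs x \<le> 1"
  shows "vabs (qnumber u x) = vabs x"
  using vabs_padic_pow(1)[OF assms] vabs_minus_commute[of 1 u]
    vabs_minus_commute[of 1 "padic_pow u x"]
  by (simp add: qnumber_def vabs_divide)

text \<open>The numerators agree by \<open>padic_pow_inverse_uminus\<close>, and the new denominator
  is \<open>- (1 - u) / u\<close>. For \<open>u = 1\<close> both sides are
  \<open>- x\<close>.\<close>

lemma qnumber_inverse_uminus:
  fixes u x :: 'a
  assumes "vabs (u - 1) < radius"
  shows "qnumber (inverse u) (- x) = - u * qnumber u x"
proof (cases "u = 1")
  case False
  moreover have "u \<noteq> 0"
    using principal_unit_nonzero[OF assms] .
  moreover have "1 - inverse u = - ((1 - u) / u)"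
    using \<open>u \<noteq> 0\<close> by (simp add: field_simps)
  ultimately show ?thesis
    using padic_pow_inverse_uminus[OF assms, of x] by (simp add: qnumber_def)
qed (simp add: qnumber_def)

section \<open>Alternating sums and the fermionic integral\<close>

text \<open>
  On integers \<open>k\<close>, the integrand of \<open>E\<^bsub>m,u\<^esub>\<^bsup>(h,1)\<^esup>(x)\<close> times the density \<open>u ^ k\<close> of the measure.
  Negative \<open>k\<close> are needed for the reflection.
\<close>

definition weight :: "int \<Rightarrow> nat \<Rightarrow> 'a \<Rightarrow> 'a \<Rightarrow> int \<Rightarrow> 'a" where
  "weight h m u x k = qnumber u (x + of_int k) ^ m * u powi (h * k)"

lemma vabs_add_of_int_le_1:
  fixes x :: 'a
  assumes "vabs x \<le> 1"
  shows "vabs (x + of_int k) \<le> 1"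
  using vabs_add_le_max[of x "of_int k"] assms vabs_of_int_le_1[of k, where 'a='a] by simp

text \<open>Both factors have value at most \<open>1\<close> and change by at most the value of
  \<open>n\<close>: the q-number by \<open>qnumber_add\<close>, the power of \<open>u\<close> by
  \<open>vabs_powi_minus_1_le\<close>.\<close>

lemma weight_Lipschitz:
  fixes u x :: 'a
  assumes u: "vabs (u - 1) < radius" and x: "vabs x \<le> 1"
  shows "vabs (weight h m u x (k + int n) - weight h m u x k) \<le> vabs (of_nat n :: 'a)"
proof -
  define a b where "a = qnumber u (x + of_int (k + int n))" and "b = qnumber u (x + of_int k)"
  define c where "c = u powi (h * int n)"
  have xk: "vabs (x + of_int k) \<le> 1"
    by (rule vabs_add_of_int_le_1[OF x])
  have a1: "vabs a \<le> 1" and b1: "vabs b \<le> 1"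
    unfolding a_def b_def using vabs_add_of_int_le_1[OF x] vabs_qnumber[OF u]
    by (simp_all del: of_int_add)
  have "a - b = padic_pow u (x + of_int k) * qnumber u (of_nat n)"
    using qnumber_add[OF u xk vabs_of_nat_le_1[of n]] by (simp add: a_def b_def add.assoc)
  then have "vabs (a - b) = vabs (of_nat n :: 'a)"
    using vabs_padic_pow(2)[OF u xk] vabs_qnumber[OF u vabs_of_nat_le_1] by (simp add: vabs_mult)
  then have ab: "vabs (a ^ m - b ^ m) \<le> vabs (of_nat n :: 'a)"
    using vabs_power_diff_le[OF a1 b1, of m] by simp
  have c1: "vabs (c - 1) \<le> vabs (of_nat n :: 'a)"
    unfolding c_def by (rule vabs_powi_minus_1_le[OF u])
  have vc: "vabs (u powi i) = 1" for i
    by (simp add: vabs_powi vabs_principal_unit[OF u])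
  have "u powi (h * (k + int n)) = u powi (h * k) * c"
    using principal_unit_nonzero[OF u] by (simp add: c_def distrib_left power_int_add)
  then have "weight h m u x (k + int n) - weight h m u x k
      = u powi (h * k) * ((a ^ m - b ^ m) * c + b ^ m * (c - 1))"
    by (simp add: weight_def a_def b_def algebra_simps)
  also have "vabs \<dots> \<le> max (vabs ((a ^ m - b ^ m) * c)) (vabs (b ^ m * (c - 1)))"
    unfolding vabs_mult[of "u powi (h * k)"] vc using vabs_add_le_max by simp
  also have "\<dots> \<le> vabs (of_nat n :: 'a)"
  proof -
    have "vabs b ^ m * vabs (c - 1) \<le> 1 * vabs (c - 1)"
      using b1 by (intro mult_right_mono power_le_one) auto
    then show ?thesis
      using ab c1 vc[of "h * int n"] by (simp add: vabs_mult vabs_power c_def)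
  qed
  finally show ?thesis .
qed

text \<open>The longer sum is cut into \<open>p\<close> blocks of length \<open>P = p ^ N\<close>.
  As \<open>P\<close> is odd, neighbouring blocks cancel up to the value of \<open>P\<close>; as
  \<open>p\<close> is odd, one block remains, the shorter sum.\<close>

lemma alternating_sum_convergent:
  fixes g :: "nat \<Rightarrow> 'a"
  assumes "odd p" and g: "\<And>n y. vabs (g (n + y) - g y) \<le> vabs (of_nat n :: 'a)"
  shows "convergent (\<lambda>N. \<Sum>y<p ^ N. (-1) ^ y * g y)"
proof (rule convergent_of_vabs_increments[OF complete_UNIV _ vabs_p_power_tendsto])
  fix N
  define P where "P = p ^ N"
  have "odd P"
    using \<open>odd p\<close> by (simp add: P_def)
  define S where "S n = (\<Sum>y<n. (-1) ^ y * g y)" for n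
  have "vabs (S (i * P) - (if odd i then S P else 0)) \<le> vabs (of_nat P :: 'a)" for i
  proof (induction i)
    case (Suc i)
    have "S (Suc i * P) = S P + (\<Sum>y<i * P. (-1) ^ (P + y) * g (P + y))"
      by (simp add: S_def sum_lessThan_add)
    also have "(\<Sum>y<i * P. (-1) ^ (P + y) * g (P + y))
        = - S (i * P) - (\<Sum>y<i * P. (-1) ^ y * (g (P + y) - g y))"
      using \<open>odd P\<close> by (simp add: S_def power_add right_diff_distrib sum_subtractf sum_negf)
    finally have "S (Suc i * P) - (if odd (Suc i) then S P else 0)
        = - (S (i * P) - (if odd i then S P else 0)) - (\<Sum>y<i * P. (-1) ^ y * (g (P + y) - g y))"
      by simp
    also have "vabs \<dots> \<le> max (vabs (- (S (i * P) - (if odd i then S P else 0))))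
        (vabs (\<Sum>y<i * P. (-1) ^ y * (g (P + y) - g y)))"
      by (rule vabs_diff_le_max)
    also have "\<dots> \<le> vabs (of_nat P :: 'a)"
    proof (rule max.boundedI)
      show "vabs (- (S (i * P) - (if odd i then S P else 0))) \<le> vabs (of_nat P :: 'a)"
        using Suc by (simp only: vabs_minus)
      show "vabs (\<Sum>y<i * P. (-1) ^ y * (g (P + y) - g y)) \<le> vabs (of_nat P :: 'a)"
        using g by (intro vabs_sum_le) (simp_all add: vabs_mult vabs_power)
    qed
    finally show ?case .
  qed (simp add: S_def)
  from this[of p] show "vabs ((\<Sum>y<p ^ Suc N. (-1) ^ y * g y) - (\<Sum>y<p ^ N. (-1) ^ y * g y))
      \<le> vabs (of_nat (p ^ N) :: 'a)"
    using \<open>odd p\<close> by (simp add: S_def P_def)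
qed

lemma vabs_2:
  assumes "odd p"
  shows "vabs (2 :: 'a) = 1"
proof -
  have "\<not> p dvd 2"
    using assms p_gt_1 by (auto dest!: dvd_imp_le simp: le_Suc_eq numeral_2_eq_2)
  then show ?thesis
    using vabs_of_nat_eq_1[of 2] by simp
qed

text \<open>The distance from \<open>1 + u\<close> to \<open>2\<close> is below \<open>1\<close>,
  the value of \<open>2\<close> for odd \<open>p\<close>. This keeps the denominators in the
  integral away from \<open>0\<close>.\<close>

lemma vabs_1_plus:
  fixes u :: 'a
  assumes "odd p" and "vabs (u - 1) < radius"
  shows "vabs (1 + u) = 1"
proof -
  have "vabs (1 + u) = vabs (2::'a)"
    using assms radius_less_1 by (intro vabs_eq_of_diff_less) (simp add: vabs_2)
  then show ?thesis
    using vabs_2[OF assms(1)] by simp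
qed

lemma fermionic_prefactor_tendsto:
  fixes u :: 'a
  assumes "odd p" and "vabs (u - 1) < radius"
  shows "(\<lambda>N. (1 + u) / (1 + u ^ p ^ N)) \<longlonglongrightarrow> (1 + u) / 2"
proof (rule tendsto_vabs_bound)
  fix N
  have v: "vabs (1 + u ^ p ^ N) = 1"
    by (rule vabs_1_plus[OF assms(1) vabs_power_minus_1_less[OF assms(2)]])
  then have "1 + u ^ p ^ N \<noteq> 0"
    by fastforce
  then have "(1 + u) / (1 + u ^ p ^ N) - (1 + u) / 2 = (1 + u) * (1 - u ^ p ^ N) / ((1 + u ^ p ^ N) * 2)"
    by (simp add: field_simps)
  then have "vabs ((1 + u) / (1 + u ^ p ^ N) - (1 + u) / 2)
      = vabs (1 + u) * vabs (1 - u ^ p ^ N) / (vabs (1 + u ^ p ^ N) * vabs (2 :: 'a))"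
    by (simp only: vabs_mult vabs_divide)
  then show "vabs ((1 + u) / (1 + u ^ p ^ N) - (1 + u) / 2) \<le> vabs (u ^ p ^ N - 1)"
    using v vabs_2[OF assms(1)] vabs_1_plus[OF assms] vabs_minus_commute[of 1 "u ^ p ^ N"]
    by simp
next
  show "(\<lambda>N. vabs (u ^ p ^ N - 1)) \<longlonglongrightarrow> 0"
    using power_p_power_tendsto_1[OF assms(2)] by (simp only: tendsto_iff_vabs)
qed

text \<open>Turns the definition of the integral through \<open>lim\<close> into actual convergence;
  the factor \<open>2 / (1 + u)\<close> undoes the limit of the prefactor.\<close>

lemma weight_sum_tendsto:
  fixes u x :: 'a
  assumes "odd p" and u: "vabs (u - 1) < radius" and x: "vabs x \<le> 1"
  shows "(\<lambda>N. \<Sum>y<p ^ N. (-1) ^ y * weight h m u x (int y)) \<longlonglongrightarrow> 2 / (1 + u) * qeuler p h m u x"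
proof -
  have "convergent (\<lambda>N. \<Sum>y<p ^ N. (-1) ^ y * weight h m u x (int y))"
  proof (rule alternating_sum_convergent[OF \<open>odd p\<close>])
    show "vabs (weight h m u x (int (n + y)) - weight h m u x (int y)) \<le> vabs (of_nat n :: 'a)" for n y
      using weight_Lipschitz[OF u x, of h m "int y" n] by (simp add: add.commute)
  qed
  then obtain l where l: "(\<lambda>N. \<Sum>y<p ^ N. (-1) ^ y * weight h m u x (int y)) \<longlonglongrightarrow> l"
    by (auto simp: convergent_def)
  \<comment> \<open>The density \<open>u ^ y\<close> raises the exponent \<open>h - 1\<close> of the
    integrand to \<open>h\<close>.\<close>
  have "qnumber u (x + of_nat y) ^ m * padic_pow u (of_int (h - 1) * of_nat y) * (-1) ^ y * u ^ y
      = (-1) ^ y * weight h m u x (int y)" for y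
  proof -
    have "padic_pow u (of_int (h - 1) * of_nat y) = u powi ((h - 1) * int y)"
      using padic_pow_of_int[OF u, of "(h - 1) * int y"] by simp
    then have "padic_pow u (of_int (h - 1) * of_nat y) * u ^ y = u powi ((h - 1) * int y) * u powi int y"
      by simp
    also have "\<dots> = u powi (h * int y)"
      using power_int_add[of u "(h - 1) * int y" "int y"] principal_unit_nonzero[OF u]
      by (simp add: left_diff_distrib)
    finally have "padic_pow u (of_int (h - 1) * of_nat y) * u ^ y = u powi (h * int y)" .
    then show ?thesis
      by (simp add: weight_def mult_ac)
  qed
  then have "qeuler p h m u x
      = lim (\<lambda>N. (1 + u) / (1 + u ^ p ^ N) * (\<Sum>y<p ^ N. (-1) ^ y * weight h m u x (int y)))"
    by (simp only: qeuler_def fermionic_integral_def)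
  also have "\<dots> = (1 + u) / 2 * l"
    by (intro limI tendsto_mult fermionic_prefactor_tendsto[OF \<open>odd p\<close> u] l)
  finally have "qeuler p h m u x = (1 + u) / 2 * l" .
  moreover have "1 + u \<noteq> 0"
    using vabs_1_plus[OF \<open>odd p\<close> u] by fastforce
  ultimately have "2 / (1 + u) * qeuler p h m u x = l"
    by (simp add: field_simps)
  then show ?thesis
    using l by simp
qed

section \<open>Reflection and shift of the argument\<close>

text \<open>As \<open>1 - x + (-1 - k) = - (x + k)\<close>, each q-number contributes a factor
  \<open>- u\<close>, and the powers of \<open>u\<close> differ by the exponent
  \<open>h\<close>.\<close>

lemma weight_reflection:
  fixes u x :: 'a
  assumes "vabs (u - 1) < radius"
  shows "weight h m (inverse u) (1 - x) (-1 - k) = (- u) ^ m * u powi h * weight h m u x k"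
proof -
  have "qnumber (inverse u) (1 - x + of_int (-1 - k)) = - u * qnumber u (x + of_int k)"
    using qnumber_inverse_uminus[OF assms, of "x + of_int k"] by (simp add: algebra_simps)
  moreover have "inverse u powi (h * (-1 - k)) = u powi (h + h * k)"
    by (simp add: power_int_inverse right_diff_distrib add.commute flip: power_int_minus)
  ultimately show ?thesis
    using principal_unit_nonzero[OF assms]
    by (simp only: weight_def power_mult_distrib power_int_add mult_ac simp_thms)
qed

lemma qeuler_reflection:
  fixes q x :: 'a
  assumes "odd p" and q: "vabs (q - 1) < radius" and x: "vabs x \<le> 1"
  shows "qeuler p h m (inverse q) (1 - x) = (-1) ^ m * q powi (int m + h - 1) * qeuler p h m q x"
proof -
  have inv: "vabs (inverse q - 1) < radius"
    using q by (simp add: vabs_inverse_minus_1)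
  have x': "vabs (1 - x) \<le> 1"
    using vabs_diff_le_max[of 1 x] x by simp
  have nz: "q \<noteq> 0"
    by (rule principal_unit_nonzero[OF q])
  define c where "c = (- q) ^ m * q powi h"
  have c: "vabs c = 1"
    by (simp add: c_def vabs_mult vabs_power vabs_powi vabs_principal_unit[OF q])
  let ?w = "\<lambda>k. weight h m q x k"
  let ?A = "\<lambda>N. \<Sum>y<p ^ N. (-1) ^ y * weight h m (inverse q) (1 - x) (int y)"
  let ?B = "\<lambda>N. \<Sum>y<p ^ N. (-1) ^ y * ?w (int y)"
  have "vabs (?A N - c * ?B N - 0) \<le> vabs (of_nat (p ^ N) :: 'a)" for N
  proof -
    define P where "P = p ^ N"
    have "odd P"
      using \<open>odd p\<close> by (simp add: P_def)
    have "?A N = (\<Sum>y<P. (-1) ^ (P - Suc y) * weight h m (inverse q) (1 - x) (int (P - Suc y)))"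
      unfolding P_def by (rule sum.nat_diff_reindex[symmetric])
    also have "\<dots> = (\<Sum>y<P. c * ((-1) ^ y * ?w (int y - int P)))"
    proof (rule sum.cong[OF refl])
      fix y
      assume "y \<in> {..<P}"
      then have y: "y < P" by simp
      have "int (P - Suc y) = -1 - (int y - int P)"
        using y by linarith
      then have "weight h m (inverse q) (1 - x) (int (P - Suc y)) = c * ?w (int y - int P)"
        using weight_reflection[OF q] by (simp only: c_def)
      \<comment> \<open>\<open>P - 1\<close> is even, so reversing the summation keeps every
        sign.\<close>
      moreover have "even (P - Suc y) \<longleftrightarrow> even y"
        using y \<open>odd P\<close> by presburger
      then have "(-1) ^ (P - Suc y) = ((-1) ^ y :: 'a)"
        by (simp add: minus_one_power_iff)
      ultimately show "(-1) ^ (P - Suc y) * weight h m (inverse q) (1 - x) (int (P - Suc y))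
          = c * ((-1) ^ y * ?w (int y - int P))"
        by simp
    qed
    finally have "?A N - c * ?B N - 0 = (\<Sum>y<P. c * ((-1) ^ y * (?w (int y - int P) - ?w (int y))))"
      by (simp add: P_def sum_distrib_left right_diff_distrib sum_subtractf)
    also have "vabs \<dots> \<le> vabs (of_nat P :: 'a)"
    proof (rule vabs_sum_le)
      fix y
      show "vabs (c * ((-1) ^ y * (?w (int y - int P) - ?w (int y)))) \<le> vabs (of_nat P :: 'a)"
        using weight_Lipschitz[OF q x, of h m "int y - int P" P]
          vabs_minus_commute[of "?w (int y)"] by (simp add: vabs_mult vabs_power c)
    qed simp
    finally show ?thesis
      by (simp only: P_def)
  qed
  then have "(\<lambda>N. ?A N - c * ?B N) \<longlonglongrightarrow> 0"
    by (rule tendsto_vabs_bound[OF _ vabs_p_power_tendsto])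
  moreover have "(\<lambda>N. ?A N - c * ?B N) \<longlonglongrightarrow>
      2 / (1 + inverse q) * qeuler p h m (inverse q) (1 - x) - c * (2 / (1 + q) * qeuler p h m q x)"
    by (intro tendsto_diff tendsto_mult tendsto_const weight_sum_tendsto[OF \<open>odd p\<close>] inv q x x')
  ultimately have "2 / (1 + inverse q) * qeuler p h m (inverse q) (1 - x)
      = c * (2 / (1 + q) * qeuler p h m q x)"
    using LIMSEQ_unique by fastforce
  \<comment> \<open>The two normalising factors differ by \<open>q\<close>, which lowers the
    exponent of \<open>q\<close> from \<open>m + h\<close> to \<open>m + h - 1\<close>.\<close>
  moreover have "2 / (1 + inverse q) = q * (2 / (1 + q))"
    using nz by (simp add: field_simps)
  moreover have "2 / (1 + q) \<noteq> 0"
    using vabs_1_plus[OF \<open>odd p\<close> q] by fastforce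
  ultimately have "q * qeuler p h m (inverse q) (1 - x) = c * qeuler p h m q x"
    by (simp add: mult.left_commute)
  moreover have "c = q * ((-1) ^ m * q powi (int m + h - 1))"
    using nz by (simp add: c_def power_int_add power_int_diff power_minus[of q])
  ultimately show ?thesis
    using nz by simp
qed

text \<open>Multiplication by \<open>q powi h\<close> turns the weight at \<open>x = 1\<close> into
  the weight at \<open>x = 0\<close> shifted by one, so the two alternating sums add up to
  \<open>w 0 + w (p ^ N)\<close>. Here \<open>w 0 = 0\<close> because \<open>m\<close> is positive,
  and the other term tends to \<open>0\<close>.\<close>

lemma qeuler_1:
  fixes q :: 'a
  assumes "odd p" and q: "vabs (q - 1) < radius" and "0 < m"
  shows "q powi h * qeuler p h m q 1 = - qeuler p h m q 0"
proof -
  let ?B = "\<lambda>x N. \<Sum>y<p ^ N. (-1) ^ y * weight h m q x (int y)"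
  define w where "w y = weight h m q 0 (int y)" for y
  have w0: "w 0 = 0"
    using \<open>0 < m\<close> vabs_qnumber[OF q, of 0] by (simp add: w_def weight_def)
  have shift: "q powi h * weight h m q 1 (int y) = w (Suc y)" for y
    using principal_unit_nonzero[OF q] by (simp add: w_def weight_def distrib_left power_int_add)
  have "q powi h * ?B 1 N + ?B 0 N = w (p ^ N)" for N
  proof -
    have "q powi h * ?B 1 N + ?B 0 N
        = (\<Sum>y<p ^ N. q powi h * ((-1) ^ y * weight h m q 1 (int y)) + (-1) ^ y * w y)"
      by (simp add: sum_distrib_left sum.distrib w_def)
    also have "\<dots> = (\<Sum>y<p ^ N. (-1) ^ y * (w (Suc y) + w y))"
      by (intro sum.cong refl) (simp add: distrib_left mult.left_commute flip: shift)
    finally show ?thesis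
      using alternating_telescope[of w "p ^ N"] w0 \<open>odd p\<close> by simp
  qed
  moreover have "w (p ^ N) = weight h m q 0 (0 + int (p ^ N)) - weight h m q 0 0" for N
    using w0 by (simp add: w_def)
  ultimately have "vabs (q powi h * ?B 1 N + ?B 0 N - 0) \<le> vabs (of_nat (p ^ N) :: 'a)" for N
    using weight_Lipschitz[OF q, of 0 h m 0 "p ^ N"] by simp
  then have "(\<lambda>N. q powi h * ?B 1 N + ?B 0 N) \<longlonglongrightarrow> 0"
    by (rule tendsto_vabs_bound[OF _ vabs_p_power_tendsto])
  moreover have "(\<lambda>N. q powi h * ?B 1 N + ?B 0 N) \<longlonglongrightarrow>
      q powi h * (2 / (1 + q) * qeuler p h m q 1) + 2 / (1 + q) * qeuler p h m q 0"
    by (intro tendsto_add tendsto_mult tendsto_const weight_sum_tendsto[OF \<open>odd p\<close>] q) simp_all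
  ultimately have "q powi h * (2 / (1 + q) * qeuler p h m q 1) + 2 / (1 + q) * qeuler p h m q 0 = 0"
    using LIMSEQ_unique by blast
  then have "2 / (1 + q) * (q powi h * qeuler p h m q 1 + qeuler p h m q 0) = 0"
    by (simp add: algebra_simps)
  moreover have "2 / (1 + q) \<noteq> 0"
    using vabs_1_plus[OF \<open>odd p\<close> q] by fastforce
  ultimately show ?thesis
    by (metis eq_neg_iff_add_eq_0 mult_eq_0_iff)
qed

end

theorem theorem4:
  fixes p m :: nat and h :: int and q :: "'a::ultrametric_field"
  assumes "prime p" and "odd p"
    and "is_padic_complex_field p TYPE('a)"
    and "vabs (1 - q) < real p powr (- 1 / (real p - 1))"
    and "m \<ge> 1"
  shows "(\<forall>x \<in> padic_integers.
            qeuler p h m (inverse q) (1 - x) =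
              (-1) ^ m * q powi (int m + h - 1) * qeuler p h m q x) \<and>
         qeuler p h m (inverse q) 0 =
           (-1) ^ m * q powi (int m + h - 1) * qeuler p h m q 1 \<and>
         (-1) ^ m * q powi (int m + h - 1) * qeuler p h m q 1 =
           (-1) ^ (m - 1) * q ^ (m - 1) * qeuler p h m q 0"
proof -
  interpret padic_field p "TYPE('a)"
    using assms(1,3) by unfold_locales (simp_all add: is_padic_complex_field_def)
  have q: "vabs (q - 1) < radius"
    using assms(4) by (simp add: radius_def vabs_minus_commute)
  obtain n where n: "m = Suc n"
    using assms(5) by (cases m) auto
  have "int m + h - 1 = int n + h"
    by (simp add: n)
  \<comment> \<open>The factor \<open>q powi h\<close> is split off for \<open>qeuler_1\<close>,
    whose minus sign turns \<open>(-1) ^ m\<close> into \<open>(-1) ^ (m - 1)\<close>.\<close>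
  then have "q powi (int m + h - 1) = q ^ n * q powi h"
    using principal_unit_nonzero[OF q] by (metis power_int_add power_int_of_nat)
  then have "(-1) ^ m * q powi (int m + h - 1) * qeuler p h m q 1
      = (-1) ^ (m - 1) * q ^ (m - 1) * qeuler p h m q 0"
    using qeuler_1[OF assms(2) q, of m h] by (simp add: n mult.assoc)
  moreover have "qeuler p h m (inverse q) (1 - x) = (-1) ^ m * q powi (int m + h - 1) * qeuler p h m q x"
    if "vabs x \<le> 1" for x
    using qeuler_reflection[OF assms(2) q that] .
  \<comment> \<open>The instance \<open>x = 1\<close> gives the value at
    \<open>1 - 1 = 0\<close>.\<close>
  from this this[of 1] have "\<forall>x \<in> padic_integers. qeuler p h m (inverse q) (1 - x) =
      (-1) ^ m * q powi (int m + h - 1) * qeuler p h m q x"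
    and "qeuler p h m (inverse q) 0 = (-1) ^ m * q powi (int m + h - 1) * qeuler p h m q 1"
    by (simp_all add: padic_integers_def)
  ultimately show ?thesis by blast
qed

end
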